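(* Let $E$ be a Polish space with Borel $\sigma$-field $\mathcal B$. Let $P$ be a stochastic kernel on $E$ for which there exist a measurable function $s:E\to[0,1]$ and a probability measure $\nu$ on $E$ with $\nu(s)>0$ and $P(x,A)\ge s(x)\nu(A)$ for all $(x,A)\in E\times\mathcal B$. Let $Q(x,A)=P(x,A)-s(x)\nu(A)$ and assume $\sum_{n\ge0}\nu Q^n(1)<\infty$. Let $\mu=\bigl(\sum_{n\ge0}\nu Q^n(1)\bigr)^{-1}\sum_{n\ge0}\nu Q^n$, which is the unique invariant probability measure of $P$, and let $(X_i)_{i\in\mathbb N}$ be the stationary Markov chain with kernel $P$ (so that $X_0$ has law $\mu$). Let $(A_k)_{k>0}$ be a sequence of Borel subsets of $E$ such that $\sum_{k>0}\nu(A_k)=\infty$ and $A_{k+1}\subset A_k$ for every $k>0$. Then $\sum_{k>0}\mathbf 1_{A_k}(X_k)=\infty$ almost surely.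
   Context: $\nu(s)=\int s\,d\nu$; $Q$ is a sub-stochastic kernel, $\nu Q^n$ is the measure $A\mapsto\int Q^n(x,A)\,d\nu(x)$ and $\nu Q^n(1)=\nu Q^n(E)$ is its total mass. *)

theory Defs
  imports "HOL-Probability.Probability"
begin

text \<open>\<open>Q(x, A) = P(x, A) - s(x) \<nu>(A)\<close>. The subtraction of \<^const>\<open>diff_measure\<close> is that of
  \<^typ>\<open>ennreal\<close>, so this is the intended kernel only under the minorization
  \<open>P(x, A) \<ge> s(x) \<nu>(A)\<close>, where no truncation occurs.\<close>

definition residual_kernel ::
    "('a \<Rightarrow> 'a measure) \<Rightarrow> ('a \<Rightarrow> real) \<Rightarrow> 'a measure \<Rightarrow> 'a \<Rightarrow> 'a measure" where
  "residual_kernel P s \<nu> x = diff_measure (P x) (scale_measure (ennreal (s x)) \<nu>)"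

fun kernel_power :: "('a::topological_space \<Rightarrow> 'a measure) \<Rightarrow> nat \<Rightarrow> 'a \<Rightarrow> 'a measure" where
  "kernel_power Q 0 x = return borel x"
| "kernel_power Q (Suc n) x = Q x \<bind> kernel_power Q n"

definition measure_kernel_power ::
    "'a::topological_space measure \<Rightarrow> ('a \<Rightarrow> 'a measure) \<Rightarrow> nat \<Rightarrow> 'a measure" where
  "measure_kernel_power \<nu> Q n = \<nu> \<bind> kernel_power Q n"

definition total_mass :: "'a measure \<Rightarrow> ennreal" where
  "total_mass M = emeasure M (space M)"

definition series_measure :: "(nat \<Rightarrow> 'a::topological_space measure) \<Rightarrow> 'a measure" where
  "series_measure m = measure_of UNIV (sets borel) (\<lambda>A. \<Sum>n. emeasure (m n) A)"

text \<open>\<open>(\<Sum>\<^sub>n \<nu>Q\<^sup>n(1))\<^sup>-\<^sup>1 \<Sum>\<^sub>n \<nu>Q\<^sup>n\<close>\<close>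

definition normalized_potential ::
    "'a::topological_space measure \<Rightarrow> ('a \<Rightarrow> 'a measure) \<Rightarrow> 'a measure" where
  "normalized_potential \<nu> Q =
     scale_measure (inverse (\<Sum>n. total_mass (measure_kernel_power \<nu> Q n)))
       (series_measure (measure_kernel_power \<nu> Q))"

definition natural_filtration ::
    "'b measure \<Rightarrow> (nat \<Rightarrow> 'b \<Rightarrow> 'a::topological_space) \<Rightarrow> nat \<Rightarrow> 'b measure" where
  "natural_filtration M X n =
     sigma (space M) (\<Union>i\<le>n. {X i -` B \<inter> space M | B. B \<in> sets borel})"

text \<open>A Markov chain, with respect to its natural filtration, with transition kernel \<open>P\<close> and
  initial law \<open>\<mu>\<close>, defined on the probability space \<open>M\<close>. Stationarity is not imposed
  separately: it holds as soon as \<open>\<mu>\<close> is invariant under \<open>P\<close>.\<close>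

definition markov_chain ::
    "'b measure \<Rightarrow> ('a::topological_space \<Rightarrow> 'a measure) \<Rightarrow> 'a measure
       \<Rightarrow> (nat \<Rightarrow> 'b \<Rightarrow> 'a) \<Rightarrow> bool" where
  "markov_chain M P \<mu> X \<longleftrightarrow>
     prob_space M \<and>
     (\<forall>n. X n \<in> measurable M borel) \<and>
     distr M borel (X 0) = \<mu> \<and>
     (\<forall>n. \<forall>B\<in>sets borel. AE \<omega> in M.
        real_cond_exp M (natural_filtration M X n)
          (indicator (X (Suc n) -` B \<inter> space M)) \<omega> = measure (P (X n \<omega>)) B)"

end

theory Submission
  imports Defs
begin

text \<open>
  Let \<open>h\<^sub>n(x)\<close> be the probability that the chain, started from \<open>x\<close> at time \<open>n\<close>, avoids
  \<open>A\<^sub>n, A\<^sub>n\<^sub>+\<^sub>1, \<dots>\<close> at the respective times, and let \<open>u\<^sub>n = \<nu>(h\<^sub>n)\<close>, which increases with \<open>n\<close> because the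
  sets decrease. Since \<open>P = Q + s \<otimes> \<nu>\<close>, iterating \<open>h\<^sub>n = 1\<^bsub>E - A\<^sub>n\<^esub> (Q h\<^sub>n\<^sub>+\<^sub>1 + s u\<^sub>n\<^sub>+\<^sub>1)\<close> and integrating
  against \<open>\<nu>\<close> gives a renewal inequality with a defect,
  \<open>u\<^sub>n + u\<^sub>n\<^sub>+\<^sub>1 \<nu>(A\<^sub>n) \<le> (\<Sum>j<k. p\<^sub>j u\<^sub>n\<^sub>+\<^sub>j\<^sub>+\<^sub>1) + r\<^sub>k\<close>, where \<open>p\<^sub>j = \<nu>Q\<^sup>j(s)\<close> and \<open>r\<^sub>k = \<nu>Q\<^sup>k(1)\<close>.
  The law \<open>p\<close> has mean \<open>\<Sum>k. r\<^sub>k < \<infinity>\<close>, so telescoping over \<open>n\<close> bounds \<open>\<Sum>n. u\<^sub>n\<^sub>+\<^sub>1 \<nu>(A\<^sub>n)\<close> by this mean.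
  As \<open>\<Sum>n. \<nu>(A\<^sub>n) = \<infinity>\<close> and \<open>u\<close> increases, \<open>u = 0\<close>. Then \<open>h\<^sub>n \<le> Q\<^sup>k 1\<close> for all \<open>k\<close>, and the limit of
  \<open>Q\<^sup>k 1\<close> vanishes almost surely along the chain. No regeneration times, hence no extension of the
  probability space, are needed.
\<close>

section \<open>Real sequences: the renewal inequality with a defect\<close>

text \<open>As \<open>p\<close> has partial sums \<open>1 - r k\<close>, subtracting
  \<open>u n\<close> leaves increments of \<open>u\<close> weighted by \<open>p\<close>. Summed over
  \<open>n\<close>, those of length \<open>Suc j\<close> total at most \<open>Suc j\<close>, and the
  mean of \<open>p\<close> is at most \<open>suminf r\<close>.\<close>

lemma renewal_defect_sum_le:
  fixes a p r u :: "nat \<Rightarrow> real"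
  assumes u: "\<And>n. 0 \<le> u n" "\<And>n. u n \<le> 1" "mono u"
    and r: "\<And>k. 0 \<le> r k" "r 0 = 1" "summable r"
    and p: "\<And>j. p j = r j - r (Suc j)" "\<And>j. 0 \<le> p j"
    and step: "\<And>n k. u n + u (Suc n) * a n \<le> (\<Sum>j<k. p j * u (Suc (n + j))) + r k"
  shows "(\<Sum>n<N. u (Suc n) * a n) \<le> suminf r"
proof -
  have sum_p: "(\<Sum>j<k. p j) = 1 - r k" for k
    by (induction k) (simp_all add: p r)
  \<comment> \<open>Summation by parts: the mean of \<open>p\<close>, truncated at \<open>k\<close>,
    through its tails \<open>r\<close>.\<close>
  have sum_Suc_p: "(\<Sum>j<k. real (Suc j) * p j) + real k * r k = (\<Sum>i<k. r i)" for k
    by (induction k) (simp_all add: p algebra_simps)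
  \<comment> \<open>An increment of length \<open>Suc j\<close> is split into unit steps; at each
    offset \<open>i\<close> the sum over \<open>n\<close> collapses to
    \<open>u (N + i) - u i\<close>, which is at most 1.\<close>
  have telescope: "(\<Sum>n<N. u (Suc (n + j)) - u n) \<le> real (Suc j)" for j
  proof -
    have "(\<Sum>n<N. u (Suc (n + j)) - u n) = (\<Sum>n<N. \<Sum>i<Suc j. u (Suc (n + i)) - u (n + i))"
      by (intro sum.cong refl) (subst sum_lessThan_telescope[where f="\<lambda>i. u (_ + i)", simplified], simp)
    also have "\<dots> = (\<Sum>i<Suc j. \<Sum>n<N. u (Suc n + i) - u (n + i))"
      by (subst sum.swap) simp
    also have "\<dots> = (\<Sum>i<Suc j. u (N + i) - u i)"
      by (intro sum.cong refl) (simp add: sum_lessThan_telescope[of "\<lambda>n. u (n + _)", simplified])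
    also have "\<dots> \<le> (\<Sum>i<Suc j. 1)"
    proof (rule sum_mono)
      fix i show "u (N + i) - u i \<le> 1"
        using u(1)[of i] u(2)[of "N + i"] by linarith
    qed
    finally show ?thesis by simp
  qed
  have bound: "(\<Sum>n<N. u (Suc n) * a n) \<le> suminf r + real N * r k" for k
  proof -
    have "u (Suc n) * a n \<le> (\<Sum>j<k. p j * (u (Suc (n + j)) - u n)) + r k" for n
    proof -
      have "(\<Sum>j<k. p j * (u (Suc (n + j)) - u n))
          = (\<Sum>j<k. p j * u (Suc (n + j))) - (1 - r k) * u n"
        by (simp add: right_diff_distrib sum_subtractf sum_p flip: sum_distrib_right)
      moreover have "r k * u n \<ge> 0" using u r by simp
      ultimately show ?thesis using step[of n k] by (simp add: algebra_simps)
    qed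
    then have "(\<Sum>n<N. u (Suc n) * a n) \<le> (\<Sum>n<N. (\<Sum>j<k. p j * (u (Suc (n + j)) - u n)) + r k)"
      by (intro sum_mono)
    also have "\<dots> = (\<Sum>j<k. p j * (\<Sum>n<N. u (Suc (n + j)) - u n)) + real N * r k"
      by (simp add: sum.distrib sum_distrib_left) (rule sum.swap)
    also have "\<dots> \<le> (\<Sum>j<k. p j * real (Suc j)) + real N * r k"
      by (intro add_right_mono sum_mono mult_left_mono telescope p)
    also have "(\<Sum>j<k. p j * real (Suc j)) \<le> (\<Sum>i<k. r i)"
      using sum_Suc_p[of k] mult_nonneg_nonneg[OF of_nat_0_le_iff[of k] r(1)[of k]]
      by (simp add: mult.commute del: of_nat_Suc)
    also have "(\<Sum>i<k. r i) \<le> suminf r"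
      by (intro sum_le_suminf) (use r in auto)
    finally show ?thesis by simp
  qed
  \<comment> \<open>\<open>N\<close> stays fixed while \<open>k\<close> grows, so the accumulated
    error \<open>N * r k\<close> vanishes.\<close>
  have "(\<lambda>k. suminf r + real N * r k) \<longlonglongrightarrow> suminf r + real N * 0"
    by (intro tendsto_intros summable_LIMSEQ_zero r)
  then show ?thesis
    using bound by (intro LIMSEQ_le_const[where X="\<lambda>k. suminf r + real N * r k"]) auto
qed

text \<open>From a positive \<open>u n\<close> on, monotonicity keeps all weights at least
  \<open>u n\<close>, so the bounded sums would make the shifted series of \<open>a\<close>
  converge.\<close>

lemma mono_eq_0_of_weighted_sum_bounded:
  fixes a u :: "nat \<Rightarrow> real"
  assumes u: "\<And>n. 0 \<le> u n" "mono u" and a: "\<And>n. 0 \<le> a n"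
    and bound: "\<And>N. (\<Sum>n<N. u (Suc n) * a n) \<le> C"
    and "\<not> summable a"
  shows "u n = 0"
proof (rule ccontr)
  assume "u n \<noteq> 0"
  then have pos: "u n > 0" using u(1)[of n] by simp
  have "(\<Sum>i<N. u n * a (i + n)) \<le> C" for N
  proof -
    have "(\<Sum>i<N. u n * a (i + n)) \<le> (\<Sum>i<N. u (Suc (i + n)) * a (i + n))"
      by (intro sum_mono mult_right_mono a monoD[OF u(2)]) auto
    also have "\<dots> = (\<Sum>i\<in>{n..<N + n}. u (Suc i) * a i)"
      by (simp add: sum.shift_bounds_nat_ivl[of _ 0 n N, simplified] atLeast0LessThan)
    also have "\<dots> \<le> (\<Sum>i<N + n. u (Suc i) * a i)"
      by (intro sum_mono2) (use u a in auto)
    finally show ?thesis using bound[of "N + n"] by linarith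
  qed
  then have "summable (\<lambda>i. u n * a (i + n))"
    using pos a by (intro bounded_imp_summable[where B=C])
      (auto simp: lessThan_Suc_atMost[symmetric] simp del: sum.lessThan_Suc)
  then have "summable (\<lambda>i. a (i + n))"
    using pos by (simp add: summable_cmult_iff)
  with \<open>\<not> summable a\<close> show False by (simp add: summable_iff_shift)
qed

section \<open>Natural filtration and the Markov property for functions\<close>

lemma space_natural_filtration: "space (natural_filtration M X n) = space M"
  by (simp add: natural_filtration_def space_measure_of_conv)

lemma sets_natural_filtration:
  "sets (natural_filtration M X n)
    = sigma_sets (space M) (\<Union>i\<le>n. {X i -` B \<inter> space M | B. B \<in> sets borel})"
  unfolding natural_filtration_def by (intro sets_measure_of) auto

lemma subalgebra_natural_filtration:
  assumes [measurable]: "\<And>n. X n \<in> measurable M borel"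
  shows "subalgebra M (natural_filtration M X n)"
  unfolding subalgebra_def sets_natural_filtration space_natural_filtration
  by (intro conjI refl sets.sigma_sets_subset) auto

lemma natural_filtration_Suc: "sets (natural_filtration M X n) \<subseteq> sets (natural_filtration M X (Suc n))"
  unfolding sets_natural_filtration by (intro sigma_sets_mono') force

lemma vimage_in_natural_filtration:
  "B \<in> sets borel \<Longrightarrow> X n -` B \<inter> space M \<in> sets (natural_filtration M X n)"
  unfolding sets_natural_filtration by (intro sigma_sets.Basic) auto

text \<open>\<open>markov_chain\<close> speaks of indicators only; linearity and monotone limits
  extend it to nonnegative functions. The past event \<open>G\<close> is carried along so that the
  property can be iterated over time.\<close>

lemma markov_chain_nn_integral:
  fixes f :: "'a::topological_space \<Rightarrow> ennreal"
  assumes chain: "markov_chain M P \<mu> X"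
    and P[measurable]: "P \<in> measurable borel (prob_algebra borel)"
    and G: "G \<in> sets (natural_filtration M X n)"
    and f: "f \<in> borel_measurable borel"
  shows "(\<integral>\<^sup>+\<omega>. indicator G \<omega> * f (X (Suc n) \<omega>) \<partial>M)
    = (\<integral>\<^sup>+\<omega>. indicator G \<omega> * (\<integral>\<^sup>+y. f y \<partial>P (X n \<omega>)) \<partial>M)"
proof -
  interpret M: prob_space M using chain by (simp add: markov_chain_def)
  have X[measurable]: "X n \<in> measurable M borel" for n
    using chain by (simp add: markov_chain_def)
  let ?F = "natural_filtration M X n"
  have sub: "subalgebra M ?F"
    by (intro subalgebra_natural_filtration X)
  interpret F: finite_measure_subalgebra M ?F
    by unfold_locales (rule sub)
  have [measurable]: "G \<in> sets M" using G sub by (auto simp: subalgebra_def)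
  have [measurable]: "P \<in> measurable borel (subprob_algebra borel)"
    by (rule measurable_prob_algebraD) (rule P)
  have sets_P[measurable_cong]: "sets (P x) = sets borel" for x
    using measurable_space[OF P, of x] by (simp add: space_prob_algebra)
  have prob_P: "prob_space (P x)" for x
    using measurable_space[OF P, of x] by (simp add: space_prob_algebra)
  have kernel_f[measurable]: "(\<lambda>x. \<integral>\<^sup>+y. f y \<partial>P x) \<in> borel_measurable borel"
    if [measurable]: "f \<in> borel_measurable borel" for f :: "'a \<Rightarrow> ennreal"
    by measurable
  show ?thesis using f
  proof (induction rule: borel_measurable_induct)
    case (cong f g)
    then have "f = g" by auto
    then show ?case using cong by simp
  next
    case (set B)
    note [measurable] = set
    let ?V = "X (Suc n) -` B \<inter> space M"
    have V[measurable]: "?V \<in> sets M" by measurable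
    \<comment> \<open>\<open>real_cond_exp\<close> is real-valued, so the indicator case is computed
      with Bochner integrals and then moved to \<open>ennreal\<close>.\<close>
    have ind: "integrable M (indicator ?V :: 'b \<Rightarrow> real)"
      by (intro integrable_real_indicator) (auto simp: M.emeasure_eq_measure)
    have "(\<integral>\<omega>. indicator G \<omega> * indicator ?V \<omega> \<partial>M)
        = (\<integral>\<omega>. indicator G \<omega> * real_cond_exp M ?F (indicator ?V) \<omega> \<partial>M)"
      using F.real_cond_exp_intA[OF ind G] by (simp add: set_lebesgue_integral_def)
    also have "\<dots> = (\<integral>\<omega>. indicator G \<omega> * measure (P (X n \<omega>)) B \<partial>M)"
    proof (intro integral_cong_AE)
      have "AE \<omega> in M. real_cond_exp M ?F (indicator ?V) \<omega> = measure (P (X n \<omega>)) B"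
        using chain set unfolding markov_chain_def by blast
      then show "AE \<omega> in M. indicator G \<omega> * real_cond_exp M ?F (indicator ?V) \<omega>
          = indicator G \<omega> * measure (P (X n \<omega>)) B"
        by eventually_elim simp
    qed measurable
    finally have eq: "(\<integral>\<omega>. indicator G \<omega> * indicator ?V \<omega> \<partial>M)
        = (\<integral>\<omega>. indicator G \<omega> * measure (P (X n \<omega>)) B \<partial>M)" .
    have "(\<integral>\<^sup>+\<omega>. indicator G \<omega> * indicator B (X (Suc n) \<omega>) \<partial>M)
        = (\<integral>\<^sup>+\<omega>. ennreal (indicator G \<omega> * indicator ?V \<omega>) \<partial>M)"
      by (intro nn_integral_cong) (auto split: split_indicator)
    also have "\<dots> = ennreal (\<integral>\<omega>. indicator G \<omega> * indicator ?V \<omega> \<partial>M)"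
      by (intro nn_integral_eq_integral M.integrable_const_bound[where B=1]) (auto split: split_indicator)
    also have "\<dots> = (\<integral>\<^sup>+\<omega>. ennreal (indicator G \<omega> * measure (P (X n \<omega>)) B) \<partial>M)"
      unfolding eq
      by (intro nn_integral_eq_integral[symmetric] M.integrable_const_bound[where B=1])
        (auto split: split_indicator intro: prob_space.prob_le_1[OF prob_P])
    also have "\<dots> = (\<integral>\<^sup>+\<omega>. indicator G \<omega> * (\<integral>\<^sup>+y. indicator B y \<partial>P (X n \<omega>)) \<partial>M)"
      by (intro nn_integral_cong)
        (auto split: split_indicator simp: finite_measure.emeasure_eq_measure[OF prob_space.finite_measure[OF prob_P]])
    finally show ?case .
  next
    case (mult f c)
    note [measurable] = mult(2)
    show ?case using mult
      by (simp add: nn_integral_cmult mult.left_commute[of _ c])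
  next
    case (add f g)
    note [measurable] = add(1,3)
    show ?case using add
      by (simp add: nn_integral_add distrib_left)
  next
    case (seq U)
    note [measurable] = seq(1)
    have "(\<integral>\<^sup>+\<omega>. indicator G \<omega> * Sup (range U) (X (Suc n) \<omega>) \<partial>M)
        = (\<integral>\<^sup>+\<omega>. (SUP i. indicator G \<omega> * U i (X (Suc n) \<omega>)) \<partial>M)"
      by (simp add: SUP_mult_left_ennreal image_comp)
    also have "\<dots> = (SUP i. \<integral>\<^sup>+\<omega>. indicator G \<omega> * U i (X (Suc n) \<omega>) \<partial>M)"
      using seq by (intro nn_integral_monotone_convergence_SUP)
        (auto simp: incseq_def le_fun_def intro!: mult_left_mono)
    also have "\<dots> = (SUP i. \<integral>\<^sup>+\<omega>. indicator G \<omega> * (\<integral>\<^sup>+y. U i y \<partial>P (X n \<omega>)) \<partial>M)"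
      using seq by simp
    also have "\<dots> = (\<integral>\<^sup>+\<omega>. (SUP i. indicator G \<omega> * (\<integral>\<^sup>+y. U i y \<partial>P (X n \<omega>))) \<partial>M)"
      using seq by (intro nn_integral_monotone_convergence_SUP[symmetric])
        (auto simp: incseq_def le_fun_def intro!: mult_left_mono nn_integral_mono)
    also have "\<dots> = (\<integral>\<^sup>+\<omega>. indicator G \<omega> * (SUP i. \<integral>\<^sup>+y. U i y \<partial>P (X n \<omega>)) \<partial>M)"
      by (simp add: SUP_mult_left_ennreal)
    also have "\<dots> = (\<integral>\<^sup>+\<omega>. indicator G \<omega> * (\<integral>\<^sup>+y. Sup (range U) y \<partial>P (X n \<omega>)) \<partial>M)"
      using seq by (simp add: image_comp nn_integral_monotone_convergence_SUP)
    finally show ?case .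
  qed
qed


section \<open>Splitting of the kernel and the action of \<open>Q\<close> on functions\<close>

text \<open>Stating the splitting \<open>P_eq\<close> additively avoids the truncated subtraction of
  \<open>ennreal\<close>; \<open>split_kernel_residual\<close> shows that the residual kernel
  fits.\<close>

locale split_kernel = prob_space \<nu> for \<nu> :: "'a::topological_space measure" +
  fixes P Q :: "'a \<Rightarrow> 'a measure" and s :: "'a \<Rightarrow> ennreal"
  assumes sets_\<nu>[measurable_cong]: "sets \<nu> = sets borel"
    and P_kernel[measurable]: "P \<in> measurable borel (prob_algebra borel)"
    and Q_kernel[measurable]: "Q \<in> measurable borel (subprob_algebra borel)"
    and s_measurable[measurable]: "s \<in> borel_measurable borel"
    and P_eq: "\<And>x B. B \<in> sets borel \<Longrightarrow> emeasure (P x) B = emeasure (Q x) B + s x * emeasure \<nu> B"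
begin

lemma space_\<nu>[simp]: "space \<nu> = UNIV"
  using sets_eq_imp_space_eq[OF sets_\<nu>] by simp

lemma sets_Q[measurable_cong]: "sets (Q x) = sets borel"
  using measurable_space[OF Q_kernel, of x] by (simp add: space_subprob_algebra)

lemma sets_P[measurable_cong]: "sets (P x) = sets borel"
  using measurable_space[OF P_kernel, of x] by (simp add: space_prob_algebra)

lemma space_P[simp]: "space (P x) = UNIV"
  using sets_eq_imp_space_eq[OF sets_P] by simp

lemma prob_space_P: "prob_space (P x)"
  using measurable_space[OF P_kernel, of x] by (simp add: space_prob_algebra)

lemma P_kernel_subprob[measurable]: "P \<in> measurable borel (subprob_algebra borel)"
  by (rule measurable_prob_algebraD) (rule P_kernel)

lemma emeasure_P_UNIV[simp]: "emeasure (P x) UNIV = 1"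
  using prob_space.emeasure_space_1[OF prob_space_P, of x] by simp

lemma emeasure_\<nu>_UNIV[simp]: "emeasure \<nu> UNIV = 1"
  using emeasure_space_1 by simp

lemma nn_integral_P:
  assumes "f \<in> borel_measurable borel"
  shows "(\<integral>\<^sup>+y. f y \<partial>P x) = (\<integral>\<^sup>+y. f y \<partial>Q x) + s x * (\<integral>\<^sup>+y. f y \<partial>\<nu>)"
  using assms
proof (induction rule: borel_measurable_induct)
  case (cong f g)
  then have "f = g" by auto
  then show ?case using cong by simp
next
  case (set B)
  then show ?case by (simp add: P_eq sets_P sets_Q sets_\<nu>)
next
  case (mult f c)
  note [measurable] = mult(2)
  show ?case using mult by (simp add: nn_integral_cmult distrib_left mult.left_commute)
next
  case (add f g)
  note [measurable] = add(1,3)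
  show ?case using add by (simp add: nn_integral_add distrib_left algebra_simps)
next
  case (seq U)
  note [measurable] = seq(1)
  have U: "(\<integral>\<^sup>+y. Sup (range U) y \<partial>N) = (SUP i. \<integral>\<^sup>+y. U i y \<partial>N)"
    if "sets N = sets borel" for N
  proof -
    note [measurable_cong] = that
    show ?thesis
      using seq by (simp add: image_comp nn_integral_monotone_convergence_SUP)
  qed
  have inc: "incseq (\<lambda>i. \<integral>\<^sup>+y. U i y \<partial>N)" for N
    using seq by (auto simp: incseq_def le_fun_def intro!: nn_integral_mono)
  show ?case
    unfolding U[OF sets_P] U[OF sets_Q] U[OF sets_\<nu>]
    using seq inc
    by (simp add: SUP_mult_left_ennreal ennreal_SUP_add incseq_def mult_left_mono)
qed

text \<open>Powers of this operator replace the kernels \<open>kernel_power Q n\<close>, so that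
  inductions concern functions; \<open>nn_integral_kernel_power\<close> links the two.\<close>

definition Qint :: "('a \<Rightarrow> ennreal) \<Rightarrow> 'a \<Rightarrow> ennreal" where
  "Qint f x = (\<integral>\<^sup>+y. f y \<partial>Q x)"

lemma Qint_measurable[measurable]:
  assumes [measurable]: "f \<in> borel_measurable borel"
  shows "Qint f \<in> borel_measurable borel"
  unfolding Qint_def by measurable

lemma Qint_funpow_measurable[measurable]:
  assumes [measurable]: "f \<in> borel_measurable borel"
  shows "(Qint ^^ n) f \<in> borel_measurable borel"
  by (induction n) simp_all

lemma Qint_mono: "(\<And>x. f x \<le> g x) \<Longrightarrow> Qint f x \<le> Qint g x"
  unfolding Qint_def by (intro nn_integral_mono)

lemma Qint_add:
  assumes [measurable]: "f \<in> borel_measurable borel" "g \<in> borel_measurable borel"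
  shows "Qint (\<lambda>x. f x + g x) x = Qint f x + Qint g x"
  unfolding Qint_def by (intro nn_integral_add) auto

lemma Qint_sum:
  assumes [measurable]: "\<And>i. f i \<in> borel_measurable borel"
  shows "Qint (\<lambda>x. \<Sum>i\<in>I. f i x) x = (\<Sum>i\<in>I. Qint (f i) x)"
  unfolding Qint_def by (intro nn_integral_sum) auto

lemma Qint_multc:
  assumes [measurable]: "f \<in> borel_measurable borel"
  shows "Qint (\<lambda>x. f x * c) x = Qint f x * c"
  unfolding Qint_def by (intro nn_integral_multc) auto

text \<open>In the split chain started from \<open>x\<close>, this is the probability of no
  regeneration during the first \<open>k\<close> transitions.\<close>

definition tail :: "nat \<Rightarrow> 'a \<Rightarrow> ennreal" where
  "tail k = (Qint ^^ k) (\<lambda>_. 1)"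

lemma tail_measurable[measurable]: "tail k \<in> borel_measurable borel"
  unfolding tail_def by measurable

lemma tail_0[simp]: "tail 0 x = 1"
  by (simp add: tail_def)

lemma tail_Suc: "tail (Suc k) = Qint (tail k)"
  by (simp add: tail_def)

text \<open>The total mass of \<open>P x\<close> gives \<open>1 = Q 1 + s\<close>, to which
  \<open>Qint\<close> is applied \<open>k\<close> times.\<close>

lemma tail_step: "tail k x = tail (Suc k) x + (Qint ^^ k) s x"
proof (induction k arbitrary: x)
  case 0
  show ?case using nn_integral_P[of "\<lambda>_. 1" x] by (simp add: tail_def Qint_def)
next
  case (Suc k)
  have "tail (Suc k) x = Qint (\<lambda>x. tail (Suc k) x + (Qint ^^ k) s x) x"
    unfolding tail_Suc[of k] by (rule arg_cong[where f="\<lambda>f. Qint f x"]) (use Suc in \<open>simp add: tail_Suc fun_eq_iff\<close>)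
  then show ?case by (simp add: Qint_add tail_Suc)
qed

lemma decseq_tail: "decseq (\<lambda>k. tail k x)"
  by (rule decseq_SucI) (subst (2) tail_step, simp)

lemma tail_le_1: "tail k x \<le> 1"
  using decseqD[OF decseq_tail, of 0 k x] by simp

text \<open>Decomposition by the first regeneration: the \<open>j\<close>-th summand is the
  probability that it occurs at transition \<open>Suc j\<close>.\<close>

lemma sum_Qint_s: "(\<Sum>j<k. (Qint ^^ j) s x) + tail k x = 1"
proof (induction k)
  case (Suc k)
  then show ?case using tail_step[of k x] by (simp add: ac_simps)
qed simp

section \<open>Avoidance probabilities and their renewal inequality\<close>

text \<open>\<open>avoid A k n x\<close> is the probability that the chain, started from \<open>x\<close> at time \<open>n\<close>, is outside \<open>A m\<close>
  at each time \<open>m\<close> with \<open>n \<le> m < n + k\<close>.\<close>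

primrec avoid :: "(nat \<Rightarrow> 'a set) \<Rightarrow> nat \<Rightarrow> nat \<Rightarrow> 'a \<Rightarrow> ennreal" where
  "avoid A 0 n x = 1"
| "avoid A (Suc k) n x = indicator (- A n) x * (\<integral>\<^sup>+y. avoid A k (Suc n) y \<partial>P x)"

definition avoid_all :: "(nat \<Rightarrow> 'a set) \<Rightarrow> nat \<Rightarrow> 'a \<Rightarrow> ennreal" where
  "avoid_all A n x = (INF k. avoid A k n x)"

context
  fixes A :: "nat \<Rightarrow> 'a set"
  assumes A[measurable]: "\<And>n. A n \<in> sets borel"
begin

lemma avoid_measurable[measurable]: "avoid A k n \<in> borel_measurable borel"
proof (induction k arbitrary: n)
  case 0
  have "avoid A 0 n = (\<lambda>_. 1)" by auto
  then show ?case by simp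
next
  case (Suc k)
  note [measurable] = Suc
  have "avoid A (Suc k) n = (\<lambda>x. indicator (- A n) x * (\<integral>\<^sup>+y. avoid A k (Suc n) y \<partial>P x))"
    by auto
  then show ?case by simp
qed

lemma avoid_Suc_le: "avoid A (Suc k) n x \<le> avoid A k n x"
proof (induction k arbitrary: n x)
  case 0
  show ?case by (auto split: split_indicator)
next
  case (Suc k)
  show ?case
    by (subst (1 2) avoid.simps(2)) (intro mult_left_mono nn_integral_mono Suc, simp)
qed

lemma decseq_avoid: "decseq (\<lambda>k. avoid A k n)"
  by (intro decseq_SucI le_funI avoid_Suc_le)

context
  assumes A_dec: "decseq A"
begin

lemma avoid_mono: "avoid A k n x \<le> avoid A k (Suc n) x"
proof (induction k arbitrary: n x)
  case (Suc k)
  have "A (Suc n) \<subseteq> A n" using A_dec by (rule decseq_SucD)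
  then show ?case
    unfolding avoid.simps
    by (intro mult_mono nn_integral_mono Suc) (auto split: split_indicator)
qed simp

lemma avoid_all_measurable[measurable]: "avoid_all A n \<in> borel_measurable borel"
  unfolding avoid_all_def by measurable

lemma avoid_all_le_avoid: "avoid_all A n x \<le> avoid A k n x"
  unfolding avoid_all_def by (intro INF_lower) simp

lemma avoid_all_le_1: "avoid_all A n x \<le> 1"
  using avoid_all_le_avoid[of n x 0] by simp

lemma avoid_all_mono: "avoid_all A n x \<le> avoid_all A (Suc n) x"
  unfolding avoid_all_def by (intro INF_mono') (rule avoid_mono)

text \<open>The recursion of \<open>avoid\<close> in the limit of large \<open>k\<close>; the
  sequence decreases from the constant 1, which is integrable, so the infimum passes under the
  integral.\<close>

lemma avoid_all_le_P:
  "avoid_all A n x \<le> indicator (- A n) x * (\<integral>\<^sup>+y. avoid_all A (Suc n) y \<partial>P x)"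
proof -
  have "(\<integral>\<^sup>+y. avoid_all A (Suc n) y \<partial>P x) = (INF k. \<integral>\<^sup>+y. avoid A k (Suc n) y \<partial>P x)"
    unfolding avoid_all_def
    by (intro nn_integral_monotone_convergence_INF_decseq[where i=0] decseq_avoid) (simp_all)
  moreover have "avoid_all A n x \<le> (INF k. \<integral>\<^sup>+y. avoid A k (Suc n) y \<partial>P x)" if "x \<notin> A n"
  proof (rule INF_greatest)
    fix k show "avoid_all A n x \<le> (\<integral>\<^sup>+y. avoid A k (Suc n) y \<partial>P x)"
      using avoid_all_le_avoid[of n x "Suc k"] that by simp
  qed
  moreover have "avoid_all A n x = 0" if "x \<in> A n"
    using that avoid_all_le_avoid[of n x 1] by simp
  ultimately show ?thesis by (cases "x \<in> A n") simp_all
qed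

definition avoid_\<nu> :: "nat \<Rightarrow> ennreal" where
  "avoid_\<nu> n = (\<integral>\<^sup>+x. avoid_all A n x \<partial>\<nu>)"

lemma avoid_\<nu>_le_1: "avoid_\<nu> n \<le> 1"
  using nn_integral_mono[of \<nu> "avoid_all A n" "\<lambda>_. 1"] avoid_all_le_1 by (simp add: avoid_\<nu>_def)

lemma mono_avoid_\<nu>: "mono avoid_\<nu>"
  unfolding mono_iff_le_Suc avoid_\<nu>_def by (intro allI nn_integral_mono avoid_all_mono)

text \<open>A regeneration at transition \<open>Suc j\<close> restarts the chain from \<nu> at time
  \<open>Suc (n + j)\<close>; if none occurs within \<open>k\<close> transitions, avoidance is
  bounded by 1.\<close>

definition renewal_bound :: "nat \<Rightarrow> nat \<Rightarrow> 'a \<Rightarrow> ennreal" where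
  "renewal_bound k n x = (\<Sum>j<k. (Qint ^^ j) s x * avoid_\<nu> (Suc (n + j))) + tail k x"

lemma renewal_bound_measurable[measurable]: "renewal_bound k n \<in> borel_measurable borel"
  unfolding renewal_bound_def by measurable

text \<open>The summand \<open>j = 0\<close> is a regeneration at once; the others are one
  application of \<open>Qint\<close> at the next time.\<close>

lemma renewal_bound_Suc:
  "renewal_bound (Suc k) n x = Qint (renewal_bound k (Suc n)) x + s x * avoid_\<nu> (Suc n)"
  unfolding renewal_bound_def
  by (subst Qint_add, measurable, subst Qint_sum, measurable)
    (simp add: sum.lessThan_Suc_shift Qint_multc tail_Suc ac_simps del: sum.lessThan_Suc)

lemma avoid_all_le_renewal_bound: "avoid_all A n x \<le> renewal_bound k n x"
proof (induction k arbitrary: n x)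
  case 0
  show ?case by (simp add: renewal_bound_def avoid_all_le_1)
next
  case (Suc k)
  have "avoid_all A n x \<le> (\<integral>\<^sup>+y. avoid_all A (Suc n) y \<partial>P x)"
    using avoid_all_le_P[of n x] by (rule order_trans) (auto split: split_indicator)
  also have "\<dots> = Qint (avoid_all A (Suc n)) x + s x * avoid_\<nu> (Suc n)"
    by (simp add: nn_integral_P Qint_def avoid_\<nu>_def)
  also have "\<dots> \<le> renewal_bound (Suc k) n x"
    unfolding renewal_bound_Suc by (intro add_right_mono Qint_mono Suc)
  finally show ?case .
qed

text \<open>By \<open>sum_Qint_s\<close> the bound is an average, with weights of sum 1, of numbers
  that are all at least \<open>avoid_\<nu> (Suc n)\<close>.\<close>

lemma avoid_\<nu>_le_renewal_bound: "avoid_\<nu> (Suc n) \<le> renewal_bound k n x"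
proof -
  have "avoid_\<nu> (Suc n) = (\<Sum>j<k. (Qint ^^ j) s x * avoid_\<nu> (Suc n)) + tail k x * avoid_\<nu> (Suc n)"
    by (simp add: sum_Qint_s flip: sum_distrib_right distrib_right)
  also have "\<dots> \<le> (\<Sum>j<k. (Qint ^^ j) s x * avoid_\<nu> (Suc (n + j))) + tail k x * 1"
    by (intro add_mono sum_mono mult_left_mono avoid_\<nu>_le_1 monoD[OF mono_avoid_\<nu>]) auto
  finally show ?thesis by (simp add: renewal_bound_def)
qed

text \<open>On \<open>A n\<close> the function \<open>avoid_all A n\<close> vanishes, which leaves
  room for the extra \<open>avoid_\<nu> (Suc n)\<close>; off \<open>A n\<close> the plain bound
  applies. Integration against \<nu> produces the defect.\<close>

lemma avoid_\<nu>_step: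
  "avoid_\<nu> n + avoid_\<nu> (Suc n) * emeasure \<nu> (A n)
    \<le> (\<Sum>j<k. (\<integral>\<^sup>+x. (Qint ^^ j) s x \<partial>\<nu>) * avoid_\<nu> (Suc (n + j))) + (\<integral>\<^sup>+x. tail k x \<partial>\<nu>)"
proof -
  have "avoid_\<nu> n + avoid_\<nu> (Suc n) * emeasure \<nu> (A n)
      = (\<integral>\<^sup>+x. avoid_all A n x + avoid_\<nu> (Suc n) * indicator (A n) x \<partial>\<nu>)"
    by (simp add: nn_integral_add nn_integral_cmult avoid_\<nu>_def[of n] sets_\<nu>)
  also have "\<dots> \<le> (\<integral>\<^sup>+x. renewal_bound k n x \<partial>\<nu>)"
  proof (intro nn_integral_mono)
    fix x
    show "avoid_all A n x + avoid_\<nu> (Suc n) * indicator (A n) x \<le> renewal_bound k n x"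
      using avoid_all_le_P[of n x] avoid_all_le_renewal_bound[of n x k] avoid_\<nu>_le_renewal_bound[of n k x]
      by (cases "x \<in> A n") simp_all
  qed
  also have "\<dots> = (\<Sum>j<k. (\<integral>\<^sup>+x. (Qint ^^ j) s x \<partial>\<nu>) * avoid_\<nu> (Suc (n + j))) + (\<integral>\<^sup>+x. tail k x \<partial>\<nu>)"
    unfolding renewal_bound_def by (simp add: nn_integral_add nn_integral_sum nn_integral_multc)
  finally show ?thesis .
qed

context
  assumes summable: "(\<Sum>k. \<integral>\<^sup>+x. tail k x \<partial>\<nu>) < \<infinity>"
    and A_sum: "(\<Sum>n. emeasure \<nu> (A n)) = \<infinity>"
begin

text \<open>All quantities are at most 1, so they pass to real numbers without loss, where the
  subtractions of the two sequence lemmas make sense.\<close>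

lemma avoid_\<nu>_eq_0: "avoid_\<nu> n = 0"
proof -
  define u where "u n = enn2real (avoid_\<nu> n)" for n
  define r where "r k = enn2real (\<integral>\<^sup>+x. tail k x \<partial>\<nu>)" for k
  define p where "p j = enn2real (\<integral>\<^sup>+x. (Qint ^^ j) s x \<partial>\<nu>)" for j
  have le_1_eq: "x = ennreal (enn2real x)" if "x \<le> 1" for x
    using ennreal_enn2real[OF le_less_trans[OF that ennreal_one_less_top]] by simp
  have tail_le: "(\<integral>\<^sup>+x. tail k x \<partial>\<nu>) \<le> 1" for k
    using nn_integral_mono[of \<nu> "tail k" "\<lambda>_. 1"] tail_le_1 by simp
  have tail_eq: "(\<integral>\<^sup>+x. tail k x \<partial>\<nu>) = (\<integral>\<^sup>+x. tail (Suc k) x \<partial>\<nu>) + (\<integral>\<^sup>+x. (Qint ^^ k) s x \<partial>\<nu>)" for k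
    by (subst tail_step) (simp add: nn_integral_add)
  have s_le: "(\<integral>\<^sup>+x. (Qint ^^ k) s x \<partial>\<nu>) \<le> 1" for k
    by (rule order_trans[OF _ tail_le[of k]]) (subst tail_eq, simp)
  have u_eq: "avoid_\<nu> n = ennreal (u n)" for n
    unfolding u_def by (rule le_1_eq[OF avoid_\<nu>_le_1])
  have r_eq: "(\<integral>\<^sup>+x. tail k x \<partial>\<nu>) = ennreal (r k)" for k
    unfolding r_def by (rule le_1_eq[OF tail_le])
  have p_eq: "(\<integral>\<^sup>+x. (Qint ^^ k) s x \<partial>\<nu>) = ennreal (p k)" for k
    unfolding p_def by (rule le_1_eq[OF s_le])
  have nonneg: "0 \<le> u n" "0 \<le> r n" "0 \<le> p n" for n
    by (simp_all add: u_def r_def p_def)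
  have u_le: "u n \<le> 1" for n using avoid_\<nu>_le_1[of n] by (simp add: u_eq)
  have u_mono: "mono u" using mono_avoid_\<nu> by (auto simp: mono_def u_eq nonneg)
  have r_0: "r 0 = 1" by (simp add: r_def)
  have r_summable: "summable r"
    using summable unfolding r_eq by (intro summable_suminf_not_top) (auto simp: nonneg)
  have p_r: "p j = r j - r (Suc j)" for j
    using tail_eq[of j] by (simp add: r_eq p_eq nonneg flip: ennreal_plus)
  have step: "u n + u (Suc n) * measure \<nu> (A n) \<le> (\<Sum>j<k. p j * u (Suc (n + j))) + r k" for n k
    using avoid_\<nu>_step[of n k]
    by (simp add: u_eq r_eq p_eq emeasure_eq_measure nonneg sum_nonneg sum_ennreal
        flip: ennreal_plus ennreal_mult)
  have bound: "(\<Sum>n<N. u (Suc n) * measure \<nu> (A n)) \<le> suminf r" for N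
    by (rule renewal_defect_sum_le[where u=u and r=r and p=p and a="\<lambda>n. measure \<nu> (A n)"])
      (fact nonneg u_le u_mono r_0 r_summable p_r step)+
  have "\<not> Series.summable (\<lambda>n. measure \<nu> (A n))"
    using A_sum by (auto simp: emeasure_eq_measure suminf_ennreal2)
  with nonneg(1) u_mono measure_nonneg bound have "u n = 0"
    by (rule mono_eq_0_of_weighted_sum_bounded[where u=u and a="\<lambda>n. measure \<nu> (A n)"])
  then show ?thesis by (simp add: u_eq)
qed

lemma avoid_all_le_tail: "avoid_all A n x \<le> tail k x"
  using avoid_all_le_renewal_bound[of n x k] by (simp add: renewal_bound_def avoid_\<nu>_eq_0)

end

end

end

section \<open>The probability of never regenerating\<close>

definition tail_limit :: "'a \<Rightarrow> ennreal" where
  "tail_limit x = (INF k. tail k x)"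

lemma tail_limit_measurable[measurable]: "tail_limit \<in> borel_measurable borel"
  unfolding tail_limit_def by measurable

lemma Qint_tail_limit_le: "Qint tail_limit x \<le> tail_limit x"
  unfolding tail_limit_def[of x]
proof (rule INF_greatest)
  fix k
  have "Qint tail_limit x \<le> tail (Suc k) x"
    unfolding tail_Suc by (rule Qint_mono) (auto simp: tail_limit_def intro: INF_lower)
  also have "\<dots> \<le> tail k x" by (rule decseqD[OF decseq_tail]) simp
  finally show "Qint tail_limit x \<le> tail k x" .
qed

lemma Qint_funpow_tail_limit_le: "(Qint ^^ n) tail_limit x \<le> tail_limit x"
proof (induction n arbitrary: x)
  case (Suc n)
  have "(Qint ^^ Suc n) tail_limit x \<le> Qint tail_limit x"
    using Suc by (auto intro: Qint_mono)
  also note Qint_tail_limit_le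
  finally show ?case .
qed simp

text \<open>This integral is a lower bound for every term of a convergent series.\<close>

lemma nn_integral_\<nu>_tail_limit:
  assumes "(\<Sum>k. \<integral>\<^sup>+x. tail k x \<partial>\<nu>) < \<infinity>"
  shows "(\<integral>\<^sup>+x. tail_limit x \<partial>\<nu>) = 0"
proof -
  let ?c = "\<integral>\<^sup>+x. tail_limit x \<partial>\<nu>"
  have le: "?c \<le> (\<integral>\<^sup>+x. tail k x \<partial>\<nu>)" for k
    by (intro nn_integral_mono) (auto simp: tail_limit_def intro: INF_lower)
  have "?c \<le> 1" using le[of 0] by simp
  then obtain c where c: "?c = ennreal c" "0 \<le> c"
    by (cases ?c) (auto simp: top_unique)
  have "(\<Sum>k::nat. ennreal c) \<le> (\<Sum>k. \<integral>\<^sup>+x. tail k x \<partial>\<nu>)"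
    using le by (intro suminf_le) (simp_all add: c)
  also note assms
  finally have "Series.summable (\<lambda>k::nat. c)"
    using c by (intro summable_suminf_not_top) auto
  then show ?thesis by (simp add: c summable_const_iff)
qed

text \<open>The \<nu>-part of \<open>P\<close> contributes 0, so \<open>tail_limit\<close> is
  superharmonic for \<open>P\<close> as it is for \<open>Q\<close>, and its expectation cannot grow
  along the chain.\<close>

lemma nn_integral_P_tail_limit_le:
  assumes "(\<Sum>k. \<integral>\<^sup>+x. tail k x \<partial>\<nu>) < \<infinity>"
  shows "(\<integral>\<^sup>+y. tail_limit y \<partial>P x) \<le> tail_limit x"
  using Qint_tail_limit_le[of x] by (simp add: nn_integral_P nn_integral_\<nu>_tail_limit[OF assms] Qint_def)

section \<open>Kernel powers and the normalized potential as measures\<close>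

lemma kernel_power_measurable[measurable]: "kernel_power Q n \<in> measurable borel (subprob_algebra borel)"
proof (induction n)
  case 0
  have "kernel_power Q 0 = return borel" by auto
  then show ?case by simp
next
  case (Suc n)
  note [measurable] = Suc
  have "kernel_power Q (Suc n) = (\<lambda>x. Q x \<bind> kernel_power Q n)" by auto
  also have "\<dots> \<in> measurable borel (subprob_algebra borel)"
    by (rule measurable_bind2[OF Q_kernel Suc])
  finally show ?case .
qed

lemma nn_integral_kernel_power:
  assumes [measurable]: "f \<in> borel_measurable borel"
  shows "(\<integral>\<^sup>+y. f y \<partial>kernel_power Q n x) = (Qint ^^ n) f x"
proof (induction n arbitrary: x)
  case 0
  show ?case by (simp add: nn_integral_return)
next
  case (Suc n)
  have "(\<integral>\<^sup>+y. f y \<partial>kernel_power Q (Suc n) x) = (\<integral>\<^sup>+y. \<integral>\<^sup>+z. f z \<partial>kernel_power Q n y \<partial>Q x)"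
    unfolding kernel_power.simps by (rule nn_integral_bind) measurable
  then show ?case by (simp add: Suc Qint_def)
qed

lemma sets_measure_kernel_power[measurable_cong]: "sets (measure_kernel_power \<nu> Q n) = sets borel"
  unfolding measure_kernel_power_def by (rule sets_bind_measurable[where B=borel]) auto

lemma nn_integral_measure_kernel_power:
  assumes [measurable]: "f \<in> borel_measurable borel"
  shows "(\<integral>\<^sup>+y. f y \<partial>measure_kernel_power \<nu> Q n) = (\<integral>\<^sup>+x. (Qint ^^ n) f x \<partial>\<nu>)"
  unfolding measure_kernel_power_def
  by (subst nn_integral_bind[where B=borel]) (simp_all add: nn_integral_kernel_power)

lemma total_mass_measure_kernel_power:
  "total_mass (measure_kernel_power \<nu> Q n) = (\<integral>\<^sup>+x. tail n x \<partial>\<nu>)"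
  using nn_integral_measure_kernel_power[of "\<lambda>_. 1" n] by (simp add: tail_def total_mass_def)

text \<open>Each measure in the series gives \<open>tail_limit\<close> integral 0, because
  \<open>Qint\<close> iterates do not increase it and \<nu> gives it integral 0.\<close>

lemma nn_integral_normalized_potential_tail_limit:
  assumes "(\<Sum>k. \<integral>\<^sup>+x. tail k x \<partial>\<nu>) < \<infinity>"
  shows "(\<integral>\<^sup>+x. tail_limit x \<partial>normalized_potential \<nu> Q) = 0"
proof -
  \<comment> \<open>The claim becomes the nullity of one set, as the potential is defined by its
    values on sets.\<close>
  let ?B = "{x. tail_limit x \<noteq> 0}"
  have sets: "sets (normalized_potential \<nu> Q) = sets borel"
    by (simp add: normalized_potential_def series_measure_def sets_measure_of_conv sets.sigma_sets_eq[of borel, simplified])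
  note [measurable_cong] = sets
  have "emeasure (measure_kernel_power \<nu> Q n) ?B = 0" for n
  proof -
    have "(\<integral>\<^sup>+x. tail_limit x \<partial>measure_kernel_power \<nu> Q n) \<le> (\<integral>\<^sup>+x. tail_limit x \<partial>\<nu>)"
      by (simp add: nn_integral_measure_kernel_power nn_integral_mono Qint_funpow_tail_limit_le)
    then show ?thesis
      by (simp add: nn_integral_\<nu>_tail_limit[OF assms] nn_integral_0_iff
          sets_eq_imp_space_eq[OF sets_measure_kernel_power])
  qed
  \<comment> \<open>\<open>measure_of\<close> is the null measure where countable additivity fails, so the latter need not be checked.\<close>
  then have "emeasure (normalized_potential \<nu> Q) ?B = 0"
    by (simp add: normalized_potential_def series_measure_def emeasure_measure_of_conv)
  then show ?thesis
    by (simp add: nn_integral_0_iff sets_eq_imp_space_eq[OF sets])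
qed

end

section \<open>Hitting probabilities along the stationary chain\<close>

locale split_chain = split_kernel \<nu> P Q s
  for \<nu> :: "'a::topological_space measure" and P Q s +
  fixes M :: "'b measure" and X :: "nat \<Rightarrow> 'b \<Rightarrow> 'a"
  assumes summable: "(\<Sum>k. \<integral>\<^sup>+x. tail k x \<partial>\<nu>) < \<infinity>"
    and chain: "markov_chain M P (normalized_potential \<nu> Q) X"
begin

lemma X_measurable[measurable]: "X n \<in> measurable M borel"
  using chain by (simp add: markov_chain_def)

lemma prob_space_M: "prob_space M"
  using chain by (simp add: markov_chain_def)

lemma nn_integral_tail_limit_X: "(\<integral>\<^sup>+\<omega>. tail_limit (X n \<omega>) \<partial>M) = 0"
proof (induction n)
  case 0
  have "(\<integral>\<^sup>+\<omega>. tail_limit (X 0 \<omega>) \<partial>M) = (\<integral>\<^sup>+x. tail_limit x \<partial>distr M borel (X 0))"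
    by (simp add: nn_integral_distr)
  also have "distr M borel (X 0) = normalized_potential \<nu> Q"
    using chain by (simp add: markov_chain_def)
  finally show ?case
    by (simp add: nn_integral_normalized_potential_tail_limit[OF summable])
next
  case (Suc n)
  have "(\<integral>\<^sup>+\<omega>. tail_limit (X (Suc n) \<omega>) \<partial>M) = (\<integral>\<^sup>+\<omega>. indicator (space M) \<omega> * tail_limit (X (Suc n) \<omega>) \<partial>M)"
    by (intro nn_integral_cong) simp
  also have "\<dots> = (\<integral>\<^sup>+\<omega>. indicator (space M) \<omega> * (\<integral>\<^sup>+y. tail_limit y \<partial>P (X n \<omega>)) \<partial>M)"
    using sets.top[of "natural_filtration M X n"]
    by (intro markov_chain_nn_integral[OF chain]) (simp_all add: space_natural_filtration)
  also have "\<dots> \<le> (\<integral>\<^sup>+\<omega>. tail_limit (X n \<omega>) \<partial>M)"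
    by (intro nn_integral_mono) (simp add: nn_integral_P_tail_limit_le[OF summable])
  finally show ?case using Suc by simp
qed

text \<open>Induction with \<open>G\<close> arbitrary: avoiding \<open>A n\<close> at time
  \<open>n\<close> is absorbed into the past event, which also belongs to the filtration at time
  \<open>Suc n\<close>.\<close>

lemma emeasure_avoid:
  assumes [measurable]: "\<And>n. A n \<in> sets borel"
    and "G \<in> sets (natural_filtration M X n)"
  shows "emeasure M (G \<inter> {\<omega>\<in>space M. \<forall>i<k. X (n + i) \<omega> \<notin> A (n + i)})
    = (\<integral>\<^sup>+\<omega>. indicator G \<omega> * avoid A k n (X n \<omega>) \<partial>M)"
  using assms(2)
proof (induction k arbitrary: n G)
  case 0
  then have "G \<in> sets M"
    using subalgebra_natural_filtration[of X, OF X_measurable] by (auto simp: subalgebra_def)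
  then show ?case
    using sets.sets_into_space[of G M] by (simp add: Int_absorb2)
next
  case (Suc k)
  let ?G = "G \<inter> (X n -` (- A n) \<inter> space M)"
  have G: "?G \<in> sets (natural_filtration M X n)"
    by (intro sets.Int Suc.prems vimage_in_natural_filtration) simp
  have "G \<inter> {\<omega>\<in>space M. \<forall>i<Suc k. X (n + i) \<omega> \<notin> A (n + i)}
      = ?G \<inter> {\<omega>\<in>space M. \<forall>i<k. X (Suc n + i) \<omega> \<notin> A (Suc n + i)}"
    by (auto simp: less_Suc_eq_0_disj)
  then have "emeasure M (G \<inter> {\<omega>\<in>space M. \<forall>i<Suc k. X (n + i) \<omega> \<notin> A (n + i)})
      = (\<integral>\<^sup>+\<omega>. indicator ?G \<omega> * avoid A k (Suc n) (X (Suc n) \<omega>) \<partial>M)"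
    using Suc.IH[of ?G "Suc n"] G natural_filtration_Suc[of M X n] by auto
  also have "\<dots> = (\<integral>\<^sup>+\<omega>. indicator ?G \<omega> * (\<integral>\<^sup>+y. avoid A k (Suc n) y \<partial>P (X n \<omega>)) \<partial>M)"
    by (intro markov_chain_nn_integral[OF chain _ G]) (auto intro: avoid_measurable assms)
  also have "\<dots> = (\<integral>\<^sup>+\<omega>. indicator G \<omega> * avoid A (Suc k) n (X n \<omega>) \<partial>M)"
    by (intro nn_integral_cong) (auto split: split_indicator)
  finally show ?case .
qed

text \<open>The probability of never hitting from time \<open>n\<close> on is at most the
  expectation of \<open>avoid_all A n\<close>, hence of \<open>tail_limit\<close>, at
  \<open>X n\<close>, which is 0.\<close>

lemma AE_hits_after:
  assumes A[measurable]: "\<And>n. A n \<in> sets borel" and dec: "decseq A"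
    and A_sum: "(\<Sum>n. emeasure \<nu> (A n)) = \<infinity>"
  shows "AE \<omega> in M. \<exists>i. X (n + i) \<omega> \<in> A (n + i)"
proof -
  interpret M: prob_space M by (rule prob_space_M)
  note [measurable] = avoid_measurable[of A, OF A]
  let ?N = "{\<omega>\<in>space M. \<forall>i. X (n + i) \<omega> \<notin> A (n + i)}"
  have "emeasure M ?N \<le> (INF k. \<integral>\<^sup>+\<omega>. avoid A k n (X n \<omega>) \<partial>M)"
  proof (rule INF_greatest)
    fix k
    have "emeasure M ?N \<le> emeasure M (space M \<inter> {\<omega>\<in>space M. \<forall>i<k. X (n + i) \<omega> \<notin> A (n + i)})"
      by (intro emeasure_mono) auto
    also have "\<dots> = (\<integral>\<^sup>+\<omega>. indicator (space M) \<omega> * avoid A k n (X n \<omega>) \<partial>M)"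
      using sets.top[of "natural_filtration M X n"]
      by (intro emeasure_avoid A) (simp add: space_natural_filtration)
    also have "\<dots> = (\<integral>\<^sup>+\<omega>. avoid A k n (X n \<omega>) \<partial>M)"
      by (intro nn_integral_cong) simp
    finally show "emeasure M ?N \<le> (\<integral>\<^sup>+\<omega>. avoid A k n (X n \<omega>) \<partial>M)" .
  qed
  also have "\<dots> = (\<integral>\<^sup>+\<omega>. (INF k. avoid A k n (X n \<omega>)) \<partial>M)"
    by (intro nn_integral_monotone_convergence_INF_decseq[where i=0, symmetric]
          decseq_SucI le_funI avoid_Suc_le[OF A])
      (simp_all add: M.emeasure_space_1)
  also have "\<dots> \<le> (\<integral>\<^sup>+\<omega>. tail_limit (X n \<omega>) \<partial>M)"
    using avoid_all_le_tail[OF A dec summable A_sum]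
    by (intro nn_integral_mono) (auto simp: tail_limit_def avoid_all_def intro!: INF_greatest)
  finally have "emeasure M ?N = 0" by (simp add: nn_integral_tail_limit_X)
  then show ?thesis by (intro AE_I[where N="?N"]) auto
qed

end

section \<open>From infinitely many hits to the theorem\<close>

lemma suminf_indicator_eq_infinity:
  assumes "\<exists>\<^sub>F k in sequentially. x k \<in> A k"
  shows "(\<Sum>k. indicator (A k) (x k) :: ennreal) = \<infinity>"
proof (rule ccontr)
  assume "\<not> ?thesis"
  then have "summable (\<lambda>k. indicator (A k) (x k) :: real)"
    by (intro summable_suminf_not_top) (simp_all add: ennreal_indicator)
  then have "(\<lambda>k. indicator (A k) (x k) :: real) \<longlonglongrightarrow> 0"
    by (rule summable_LIMSEQ_zero)
  then have "\<forall>\<^sub>F k in sequentially. (indicator (A k) (x k) :: real) < 1"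
    by (rule order_tendstoD) simp
  then have "\<forall>\<^sub>F k in sequentially. x k \<notin> A k"
    by eventually_elim (auto split: split_indicator_asm)
  with assms show False by (simp add: frequently_def)
qed

text \<open>By the minorization nothing is truncated, so the subtracted part can be added back;
  domination by \<open>P x\<close> makes the residual sub-stochastic.\<close>

lemma split_kernel_residual:
  fixes P :: "'a::topological_space \<Rightarrow> 'a measure"
  assumes P[measurable]: "P \<in> measurable borel (prob_algebra borel)"
    and s[measurable]: "s \<in> borel_measurable borel"
    and s_range: "\<And>x. s x \<in> {0..1}"
    and \<nu>: "prob_space \<nu>" "sets \<nu> = sets borel"
    and minorization: "\<And>x B. B \<in> sets borel \<Longrightarrow> measure (P x) B \<ge> s x * measure \<nu> B"
  shows "split_kernel \<nu> P (residual_kernel P s \<nu>) (\<lambda>x. ennreal (s x))"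
proof -
  interpret \<nu>: prob_space \<nu> by (rule \<nu>)
  have [measurable]: "P \<in> measurable borel (subprob_algebra borel)"
    by (rule measurable_prob_algebraD) (rule P)
  have sets_P: "sets (P x) = sets borel" and prob_P: "prob_space (P x)" for x
    using measurable_space[OF P, of x] by (simp_all add: space_prob_algebra)
  have le: "ennreal (s x) * emeasure \<nu> B \<le> emeasure (P x) B" if "B \<in> sets borel" for x B
    using minorization[OF that, of x] s_range[of x]
    by (simp add: \<nu>.emeasure_eq_measure finite_measure.emeasure_eq_measure[OF prob_space.finite_measure[OF prob_P]]
        flip: ennreal_mult)
  have Q: "emeasure (residual_kernel P s \<nu> x) B = emeasure (P x) B - ennreal (s x) * emeasure \<nu> B"
    if "B \<in> sets borel" for x B
    unfolding residual_kernel_def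
    by (subst emeasure_diff_measure)
      (auto simp: le sets_P \<nu> that prob_space.finite_measure[OF prob_P] ennreal_mult_eq_top_iff
        intro!: finite_measureI)
  have sets_Q: "sets (residual_kernel P s \<nu> x) = sets borel" for x
    by (simp add: residual_kernel_def sets_P)
  have Q_le: "emeasure (residual_kernel P s \<nu> x) B \<le> emeasure (P x) B" if "B \<in> sets borel" for x B
    by (simp add: Q that)
  have "subprob_space (residual_kernel P s \<nu> x)" for x
    using Q_le[of UNIV x] prob_space.emeasure_space_1[OF prob_P, of x]
    by (intro subprob_spaceI) (simp_all add: sets_eq_imp_space_eq[OF sets_P] sets_eq_imp_space_eq[OF sets_Q])
  then have "residual_kernel P s \<nu> \<in> measurable borel (subprob_algebra borel)"
    by (intro measurable_subprob_algebra) (simp_all add: sets_Q Q)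
  then show ?thesis
    by unfold_locales (simp_all add: \<nu> P Q le diff_add_cancel_ennreal)
qed

theorem theorem5p2:
  fixes P :: "'a::polish_space \<Rightarrow> 'a measure"
    and s :: "'a \<Rightarrow> real"
    and \<nu> \<mu> :: "'a measure"
    and Q :: "'a \<Rightarrow> 'a measure"
    and M :: "'b measure"
    and X :: "nat \<Rightarrow> 'b \<Rightarrow> 'a"
    and A :: "nat \<Rightarrow> 'a set"
  assumes P: "P \<in> measurable borel (prob_algebra borel)"
    and s_measurable: "s \<in> borel_measurable borel"
    and s_range: "\<And>x. s x \<in> {0..1}"
    and \<nu>: "prob_space \<nu>" "sets \<nu> = sets borel"
    and \<nu>_s: "(\<integral>x. s x \<partial>\<nu>) > 0"
    and minorization: "\<And>x B. B \<in> sets borel \<Longrightarrow> measure (P x) B \<ge> s x * measure \<nu> B"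
    and Q: "Q = residual_kernel P s \<nu>"
    and summable: "(\<Sum>n. total_mass (measure_kernel_power \<nu> Q n)) < \<infinity>"
    and \<mu>: "\<mu> = normalized_potential \<nu> Q"
    and X: "markov_chain M P \<mu> X"
    and A_borel: "\<And>k. k > 0 \<Longrightarrow> A k \<in> sets borel"
    and A_sum: "(\<Sum>k. emeasure \<nu> (A (Suc k))) = \<infinity>"
    and A_decreasing: "\<And>k. k > 0 \<Longrightarrow> A (Suc k) \<subseteq> A k"
  shows "AE \<omega> in M. (\<Sum>k. indicator (A (Suc k)) (X (Suc k) \<omega>) :: ennreal) = \<infinity>"
proof -
  interpret split_kernel \<nu> P Q "\<lambda>x. ennreal (s x)"
    unfolding Q by (rule split_kernel_residual[OF P s_measurable s_range \<nu> minorization])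
  interpret split_chain \<nu> P Q "\<lambda>x. ennreal (s x)" M X
    using summable X by unfold_locales (simp_all add: total_mass_measure_kernel_power \<mu>)
  \<comment> \<open>\<open>A 0\<close> is unconstrained; the whole space in its place gives a
    decreasing sequence of Borel sets from index 0.\<close>
  define A' where "A' k = (if k = 0 then UNIV else A k)" for k
  have "A' k \<in> sets borel" for k
    by (simp add: A'_def A_borel)
  moreover have "decseq A'"
    by (intro decseq_SucI) (auto simp: A'_def dest: A_decreasing[THEN subsetD, rotated])
  moreover have "(\<Sum>k. emeasure \<nu> (A' k)) = \<infinity>"
  proof -
    \<comment> \<open>Comparison shifted by one: \<open>A (Suc k)\<close> lies in
      \<open>A' k\<close>, trivially for \<open>k = 0\<close> and by monotonicity otherwise.\<close>
    have "(\<Sum>k. emeasure \<nu> (A (Suc k))) \<le> (\<Sum>k. emeasure \<nu> (A' k))"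
      using A_decreasing by (intro suminf_le emeasure_mono) (auto simp: A'_def A_borel sets_\<nu>)
    then show ?thesis by (simp add: A_sum top_unique)
  qed
  ultimately have "AE \<omega> in M. \<forall>n. \<exists>i. X (n + i) \<omega> \<in> A' (n + i)"
    unfolding AE_all_countable by (intro allI AE_hits_after)
  then show ?thesis
  proof eventually_elim
    case (elim \<omega>)
    have "\<exists>k\<ge>n. X (Suc k) \<omega> \<in> A (Suc k)" for n
    proof -
      \<comment> \<open>Starting at \<open>Suc n\<close> keeps the index positive, where
        \<open>A'\<close> agrees with \<open>A\<close>.\<close>
      obtain i where "X (Suc n + i) \<omega> \<in> A' (Suc n + i)" using elim by blast
      then show ?thesis by (intro exI[of _ "n + i"]) (simp add: A'_def)
    qed
    then show ?case
      by (intro suminf_indicator_eq_infinity) (simp add: frequently_sequentially)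
  qed
qed

end
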